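(* For every integer $r\ge 3$ there is a constant $c_r>0$ such that every $K_r$-free graph $G$ with $m$ edges satisfies $\mathrm{sp}(G)\ge c_r\, m^{\frac12+\frac{3}{4r-2}}$.
   Context: All graphs are finite and simple. A graph is $K_r$-free if it has no complete subgraph on $r$ vertices. $\mathrm{mc}(G)$ denotes the maximum number of edges crossing a partition of $V(G)$ into two parts, and $\mathrm{sp}(G)=\mathrm{mc}(G)-e(G)/2$. *)

theory Defs
  imports Complex_Main
begin

definition fin_simple_graph :: "'a set \<Rightarrow> 'a set set \<Rightarrow> bool" where
  "fin_simple_graph V E \<longleftrightarrow> finite V \<and> (\<forall>e\<in>E. e \<subseteq> V \<and> card e = 2)"

definition complete_subgraph_on :: "'a set \<Rightarrow> 'a set set \<Rightarrow> 'a set \<Rightarrow> bool" where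
  "complete_subgraph_on V E S \<longleftrightarrow> S \<subseteq> V \<and> (\<forall>u\<in>S. \<forall>v\<in>S. u \<noteq> v \<longrightarrow> {u, v} \<in> E)"

definition K_free :: "nat \<Rightarrow> 'a set \<Rightarrow> 'a set set \<Rightarrow> bool" where
  "K_free r V E \<longleftrightarrow> \<not> (\<exists>S. finite S \<and> card S = r \<and> complete_subgraph_on V E S)"

definition crossing_edges :: "'a set set \<Rightarrow> 'a set \<Rightarrow> 'a set \<Rightarrow> 'a set set" where
  "crossing_edges E A B = {e \<in> E. \<exists>a\<in>A. \<exists>b\<in>B. e = {a, b}}"

text \<open>
  A part may be empty. This only makes the maximum well-defined when there are fewer than two
  vertices; otherwise an empty part gives a cut of size zero and does not affect the maximum.
\<close>

definition mc :: "'a set \<Rightarrow> 'a set set \<Rightarrow> nat" where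
  "mc V E = Max {card (crossing_edges E A B) | A B. A \<union> B = V \<and> A \<inter> B = {}}"

definition sp :: "'a set \<Rightarrow> 'a set set \<Rightarrow> real" where
  "sp V E = real (mc V E) - real (card E) / 2"

end

theory Submission
  imports Defs "HOL-Real_Asymp.Real_Asymp"
begin

text \<open>
  Vectors of norm at most 1 attached to the vertices can be rounded to a cut: replace each by the
  sine of a Gaussian with covariance given by the inner products. For vertices with inner product
  \<open>\<rho>\<close> the expected product of the sines has the sign of \<open>\<rho>\<close> and is comparable to \<open>\<rho>\<close>, so negative
  correlation along the edges gives surplus.

  Such vectors come from two sources. If there are few triangles, perturbed indicators of the
  neighbourhoods are negatively correlated along edges. If there are many triangles, the
  neighbourhoods are \<open>K_(r-1)\<close>-free graphs with many edges, and concatenating vectors for all of them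
  gives vectors for the whole graph. By induction on \<open>r\<close>, a \<open>K_r\<close>-free graph with \<open>n\<close> vertices and
  \<open>m\<close> edges has surplus of order at least \<open>m * (m / n^2)^(r-2)\<close>, and applying this to the
  neighbourhoods in a \<open>K_r\<close>-free graph of maximum degree \<open>D\<close> gives surplus of order at least
  \<open>m / D^((r-2)/(r-1))\<close>. High degrees are no obstacle: unless the bipartition into vertices of high and
  low degree is already a good cut, one of the two sides spans a constant proportion of the edges.
  The two bounds balance at \<open>D = m^((r-1)/(2r-1))\<close>.
\<close>

section \<open>Gram kernels\<close>

definition gram :: "('a \<Rightarrow> real) list \<Rightarrow> 'a \<Rightarrow> 'a \<Rightarrow> real" where
  "gram fs u v = (\<Sum>f\<leftarrow>fs. f u * f v)"

text \<open>Rounding loses constant factors, so positive correlations are charged with a safety factor. The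
  result is still sublinear, which makes it compatible with concatenation of vectors.\<close>

definition penalty :: "real \<Rightarrow> real" where
  "penalty t = max t (4 * t)"

lemma penalty_add: "penalty (s + t) \<le> penalty s + penalty t"
  by (auto simp: penalty_def max_def)

lemma penalty_scale: "c \<ge> 0 \<Longrightarrow> penalty (c * t) = c * penalty t"
proof -
  assume "c \<ge> 0"
  then have "c * max t (4 * t) = max (c * t) (c * (4 * t))"
    by (simp add: max_mult_distrib_left)
  then show ?thesis by (simp add: penalty_def mult.left_commute)
qed

lemma penalty_zero [simp]: "penalty 0 = 0"
  by (simp add: penalty_def)

lemma penalty_nonneg: "t \<ge> 0 \<Longrightarrow> penalty t = 4 * t"
  by (simp add: penalty_def)

lemma penalty_nonpos: "t \<le> 0 \<Longrightarrow> penalty t = t"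
  by (simp add: penalty_def)

lemma penalty_sum: "penalty (\<Sum>i\<in>I. f i) \<le> (\<Sum>i\<in>I. penalty (f i))"
proof (induction I rule: infinite_finite_induct)
  case (insert x F)
  then show ?case using penalty_add[of "f x" "sum f F"] by simp
qed auto

lemma gram_append: "gram (fs @ gs) u v = gram fs u v + gram gs u v"
  by (simp add: gram_def)

text \<open>The factor may vary with the vertex: an indicator restricts the vectors to a set, a
  constant rescales them.\<close>

lemma gram_scale: "gram (map (\<lambda>f u. c u * f u) fs) u v = c u * c v * gram fs u v"
  by (induction fs) (auto simp: gram_def algebra_simps)

lemma gram_family:
  assumes "finite I"
  obtains fs where "\<And>u v. gram fs u v = (\<Sum>i\<in>I. gram (F i) u v)"
proof -
  have "\<exists>fs. \<forall>u v. gram fs u v = (\<Sum>i\<in>I. gram (F i) u v)"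
    using assms
  proof (induction I)
    case empty
    show ?case by (intro exI[of _ "[]"]) (simp add: gram_def)
  next
    case (insert x I)
    then obtain fs where "\<forall>u v. gram fs u v = (\<Sum>i\<in>I. gram (F i) u v)" by blast
    with insert show ?case
      by (intro exI[of _ "F x @ fs"]) (simp add: gram_append)
  qed
  with that show ?thesis by blast
qed

lemma gram_functions:
  assumes "finite I"
  obtains fs where "\<And>u v. gram fs u v = (\<Sum>i\<in>I. g i u * g i v)"
  using gram_family[OF assms, of "\<lambda>i. [g i]"] by (auto simp: gram_def)

section \<open>Convexity of powers\<close>

text \<open>In the induction step, multiplying by \<open>x\<close> yields the next tangent plus the
  nonnegative term \<open>real (Suc m) * y ^ m * (x - y)\<^sup>2\<close>.\<close>

lemma power_tangent:
  fixes x y :: real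
  assumes "x \<ge> 0" "y \<ge> 0"
  shows "x ^ Suc m \<ge> y ^ Suc m + real (Suc m) * y ^ m * (x - y)"
proof (induction m)
  case (Suc m)
  have "y ^ Suc (Suc m) + real (Suc (Suc m)) * y ^ Suc m * (x - y)
      \<le> y ^ Suc (Suc m) + real (Suc (Suc m)) * y ^ Suc m * (x - y) + real (Suc m) * y ^ m * (x - y)\<^sup>2"
    using assms by simp
  also have "\<dots> = x * (y ^ Suc m + real (Suc m) * y ^ m * (x - y))"
    by (simp add: algebra_simps power2_eq_square)
  also have "\<dots> \<le> x * x ^ Suc m" using Suc assms by (intro mult_left_mono)
  finally show ?case by simp
qed simp

text \<open>Jensen with weights \<open>d\<close>: sum the tangent bounds at the weighted mean
  \<open>y\<close>, where the linear terms cancel. Hypothesis \<open>z\<close> keeps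
  \<open>d i * (e i / d i) = e i\<close> true under the convention \<open>x / 0 = 0\<close>.\<close>

lemma weighted_power_mean:
  fixes d e :: "'a \<Rightarrow> real"
  assumes d: "\<And>i. i \<in> I \<Longrightarrow> d i \<ge> 0" and e: "\<And>i. i \<in> I \<Longrightarrow> e i \<ge> 0"
    and z: "\<And>i. i \<in> I \<Longrightarrow> d i = 0 \<Longrightarrow> e i = 0"
    and pos: "sum d I > 0"
  shows "sum d I * (sum e I / sum d I) ^ Suc m \<le> (\<Sum>i\<in>I. d i * (e i / d i) ^ Suc m)"
proof -
  define y where "y = sum e I / sum d I"
  have y: "y \<ge> 0" unfolding y_def using assms by (intro divide_nonneg_nonneg sum_nonneg) auto
  have E: "(\<Sum>i\<in>I. d i * (e i / d i)) = sum e I"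
    using z by (intro sum.cong) auto
  have "sum d I * y ^ Suc m = sum d I * y ^ Suc m + real (Suc m) * y ^ m * (sum e I - y * sum d I)"
    using pos by (simp add: y_def)
  also have "\<dots> = (\<Sum>i\<in>I. d i * (y ^ Suc m + real (Suc m) * y ^ m * (e i / d i - y)))"
  proof -
    have "(\<Sum>i\<in>I. d i * (y ^ Suc m + real (Suc m) * y ^ m * (e i / d i - y)))
        = (\<Sum>i\<in>I. y ^ Suc m * d i + real (Suc m) * y ^ m * (d i * (e i / d i) - y * d i))"
      by (intro sum.cong refl) (simp only: algebra_simps)
    also have "\<dots> = y ^ Suc m * sum d I + real (Suc m) * y ^ m * (sum e I - y * sum d I)"
      by (simp only: sum.distrib sum_subtractf sum_distrib_left[symmetric] E)
    finally show ?thesis by (simp only: mult.commute)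
  qed
  also have "\<dots> \<le> (\<Sum>i\<in>I. d i * (e i / d i) ^ Suc m)"
    using d e y by (intro sum_mono mult_left_mono power_tangent) auto
  finally show ?thesis by (simp add: y_def)
qed

section \<open>Gaussian limits of cosine products\<close>

text \<open>Central limit theorem for signs: the sequence consists of the characteristic functions
  of normalised sums of \<open>N\<close> random signs.\<close>

lemma cos_power_limit:
  fixes z :: real
  shows "(\<lambda>N. cos (z / sqrt (real N)) ^ N) \<longlonglongrightarrow> exp (- z\<^sup>2 / 2)"
proof (cases "z = 0")
  case False
  have "((\<lambda>x::real. cos (z / sqrt x) powr x) \<longlongrightarrow> exp (- z\<^sup>2 / 2)) at_top"
    using False by (real_asymp simp: power2_eq_square)
  then have "(\<lambda>N. cos (z / sqrt (real N)) powr real N) \<longlonglongrightarrow> exp (- z\<^sup>2 / 2)"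
    by (rule filterlim_compose) (rule filterlim_real_sequentially)
  \<comment> \<open>\<open>powr\<close> is rewritten as a power only for a positive base, which
    holds for large \<open>N\<close>.\<close>
  moreover have "\<forall>\<^sub>F N in sequentially. cos (z / sqrt (real N)) > 0"
    by real_asymp
  then have "\<forall>\<^sub>F N in sequentially. cos (z / sqrt (real N)) powr real N = cos (z / sqrt (real N)) ^ N"
    by eventually_elim (simp add: powr_realpow)
  ultimately show ?thesis by (rule Lim_transform_eventually)
qed simp

lemma prod_list_concat_replicate:
  "prod_list (map (g :: 'b \<Rightarrow> real) (concat (replicate N xs))) = prod_list (map g xs) ^ N"
  by (induction N) auto

lemma cos_prod_limit:
  fixes z :: "'b \<Rightarrow> real"
  shows "(\<lambda>N. prod_list (map (\<lambda>f. cos (z f / sqrt (real N))) fs) ^ N)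
           \<longlonglongrightarrow> exp (- (\<Sum>f\<leftarrow>fs. (z f)\<^sup>2) / 2)"
proof (induction fs)
  case (Cons f fs)
  from tendsto_mult[OF cos_power_limit[of "z f"] Cons] show ?case
    by (simp add: power_mult_distrib add_divide_distrib diff_divide_distrib flip: exp_add)
qed simp

text \<open>Half the left side is the expected product of sines of two Gaussians with covariance
  \<open>\<rho>\<close> and average variance \<open>s\<close>. Negative \<open>\<rho>\<close> gains
  by \<open>sinh x \<ge> x\<close> and \<open>s \<le> 1\<close>; positive \<open>\<rho>\<close>
  costs at most \<open>2 * \<rho>\<close>.\<close>

lemma exp_diff_penalty:
  fixes s \<rho> :: real
  assumes "\<rho> \<le> s" "s \<le> 1"
  shows "exp (\<rho> - s) - exp (- \<rho> - s) \<le> 2 * exp (-1) * penalty \<rho>"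
proof (cases "\<rho> \<ge> 0")
  case True
  have "1 - exp (- 2 * \<rho>) \<le> 2 * \<rho>" using exp_ge_add_one_self[of "-2 * \<rho>"] by simp
  moreover have "exp (\<rho> - s) \<le> 1" using assms by simp
  ultimately have "exp (\<rho> - s) * (1 - exp (- 2 * \<rho>)) \<le> 1 * (2 * \<rho>)"
    using True by (intro mult_mono) auto
  also have "\<dots> \<le> 2 * exp (-1) * (4 * \<rho>)"
  proof -
    \<comment> \<open>The factor 4 in \<open>penalty\<close> is large enough because it exceeds
      \<open>exp 1\<close>.\<close>
    have "exp (-1) * 4 \<ge> (1 :: real)" using exp_le by (simp add: exp_minus field_simps)
    then have "(exp (-1) * 4) * \<rho> \<ge> 1 * \<rho>" using True by (intro mult_right_mono) auto
    then show ?thesis by (simp add: mult_ac)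
  qed
  finally show ?thesis using True
    by (simp add: penalty_nonneg right_diff_distrib flip: exp_add)
next
  case False
  then have "exp (- \<rho>) - exp \<rho> \<ge> 2 * (- \<rho>)"
    using real_le_x_sinh[of "- \<rho>"] by (simp add: exp_minus)
  moreover have "exp (- s) \<ge> exp (- 1)" using assms by simp
  ultimately have "exp (- s) * (exp (- \<rho>) - exp \<rho>) \<ge> exp (- 1) * (2 * (- \<rho>))"
    using False by (intro mult_mono) auto
  then show ?thesis using False
    by (simp add: penalty_nonpos right_diff_distrib algebra_simps flip: exp_add)
qed

text \<open>The numbers come from \<open>vec_sp_bounded_degree_step\<close>: \<open>331776 = 16 * 12 * 12^3\<close> in the case of few
  triangles and \<open>55296 = 32 * 12 * 12^2\<close> in the case of many.\<close>

primrec dense_const :: "nat \<Rightarrow> real" where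
  "dense_const 0 = 1"
| "dense_const (Suc k) = min (1 / 331776) (dense_const k / (12 * 55296 ^ Suc k))"

lemma dense_const_pos: "dense_const k > 0"
  by (induction k) auto

text \<open>\<open>1 / 16\<close> is the yield of few triangles in
  \<open>vec_sp_bounded_degree\<close>, \<open>dense_const k\<close> that of many.\<close>

definition sparse_const :: "nat \<Rightarrow> real" where
  "sparse_const k = min (1 / 16) (dense_const k)"

text \<open>One term for each case of \<open>vec_sp_clique_free_edges\<close>: a good cut, a dense
  high-degree part, and a low-degree part, where \<open>288 = 12 * 24\<close>.\<close>

definition surplus_const :: "nat \<Rightarrow> real" where
  "surplus_const k = min (1 / 6) (min (dense_const (Suc k)) (sparse_const k / 288))"

section \<open>Rounding vectors to cuts\<close>

text \<open>An adjacency matrix on the whole type. A vertex set \<open>U\<close> stands for its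
  induced subgraph, so passing to neighbourhoods or degree classes changes only the set.\<close>

locale graph01 =
  fixes a :: "'a \<Rightarrow> 'a \<Rightarrow> real"
  assumes a01: "a u v = 0 \<or> a u v = 1"
    and a_sym: "a u v = a v u"
    and a_diag [simp]: "a u u = 0"
begin

text \<open>The quadratic form of the adjacency matrix: on a sign vector, twice the number of uncut
  edges minus twice the number of cut ones.\<close>

definition form :: "'a set \<Rightarrow> ('a \<Rightarrow> real) \<Rightarrow> real" where
  "form U x = (\<Sum>u\<in>U. \<Sum>v\<in>U. a u v * (x u * x v))"

lemma a_nonneg [simp]: "a u v \<ge> 0"
  using a01[of u v] by auto

lemma a_le1: "a u v \<le> 1"
  using a01[of u v] by auto

text \<open>The zero diagonal makes the form affine in each single coordinate.\<close>

lemma form_update: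
  assumes "finite U"
  shows "form U x = (1 + x w) / 2 * form U (x(w := 1)) + (1 - x w) / 2 * form U (x(w := -1))"
proof -
  have "a u v * (x u * x v) = (1 + x w) / 2 * (a u v * ((x(w := 1)) u * (x(w := 1)) v))
     + (1 - x w) / 2 * (a u v * ((x(w := -1)) u * (x(w := -1)) v))" for u v
    by (cases "u = w"; cases "v = w") (auto simp: field_simps)
  then show ?thesis
    unfolding form_def sum_distrib_left sum.distrib[symmetric]
    by (intro sum.cong refl)
qed

text \<open>A function affine in each coordinate is minimised over the cube at a vertex. The
  induction moves the coordinates in \<open>W\<close> to signs one at a time.\<close>

lemma form_cube:
  assumes fin: "finite U"
    and signs: "\<And>x. (\<And>u. x u = 1 \<or> x u = -1) \<Longrightarrow> form U x \<ge> - B"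
    and x: "\<And>u. \<bar>x u\<bar> \<le> 1"
  shows "form U x \<ge> - B"
proof -
  have "\<forall>x. (\<forall>u. \<bar>x u\<bar> \<le> 1) \<longrightarrow> (\<forall>u. u \<notin> W \<longrightarrow> x u = 1 \<or> x u = -1) \<longrightarrow> form U x \<ge> - B"
    if "finite W" for W
    using that
  proof (induction W)
    case empty
    then show ?case using signs by auto
  next
    case (insert w W)
    show ?case
    proof (intro allI impI)
      fix x :: "'a \<Rightarrow> real"
      assume x: "\<forall>u. \<bar>x u\<bar> \<le> 1" and s: "\<forall>u. u \<notin> insert w W \<longrightarrow> x u = 1 \<or> x u = -1"
      have b: "\<bar>x w\<bar> \<le> 1" using x by blast
      have "form U (x(w := 1)) \<ge> - B" "form U (x(w := -1)) \<ge> - B"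
        by (rule insert.IH[rule_format]; use x s in \<open>auto split: if_splits\<close>)+
      then have "(1 + x w) / 2 * form U (x(w := 1)) + (1 - x w) / 2 * form U (x(w := -1))
          \<ge> (1 + x w) / 2 * (- B) + (1 - x w) / 2 * (- B)"
        using b by (intro add_mono mult_left_mono) auto
      also have "(1 + x w) / 2 * (- B) + (1 - x w) / 2 * (- B) = - B" by (simp add: field_simps)
      finally show "form U x \<ge> - B" by (subst form_update[OF fin, of x w])
    qed
  qed
  \<comment> \<open>Setting the coordinates outside \<open>U\<close> to 1 leaves only finitely many
    to round and does not change the form.\<close>
  from this[OF fin, rule_format, of "\<lambda>u. if u \<in> U then x u else 1"]
  have "form U (\<lambda>u. if u \<in> U then x u else 1) \<ge> - B" using x by simp
  moreover have "form U (\<lambda>u. if u \<in> U then x u else 1) = form U x"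
    unfolding form_def by (intro sum.cong) auto
  ultimately show ?thesis by simp
qed

text \<open>
  The summand is the expectation of \<open>sin (\<theta> u + X u) * sin (\<theta> v + X v)\<close>, where \<open>X\<close> is the sum of
  the functions in \<open>fs\<close> with independent uniformly random signs.
\<close>

lemma rademacher_average:
  assumes fin: "finite U"
    and signs: "\<And>x. (\<And>u. x u = 1 \<or> x u = -1) \<Longrightarrow> form U x \<ge> - B"
  shows "(\<Sum>u\<in>U. \<Sum>v\<in>U. a u v *
            (cos (\<theta> u - \<theta> v) * prod_list (map (\<lambda>f. cos (f u - f v)) fs)
             - cos (\<theta> u + \<theta> v) * prod_list (map (\<lambda>f. cos (f u + f v)) fs))) \<ge> - (2 * B)"
    (is "?S \<theta> fs \<ge> _")
proof (induction fs arbitrary: \<theta>)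
  case Nil
  \<comment> \<open>Sines lie in the cube. The factor 2 in the bound comes from
    \<open>2 * sin x * sin y = cos (x - y) - cos (x + y)\<close>.\<close>
  have "form U (\<lambda>u. sin (\<theta> u)) \<ge> - B"
    by (rule form_cube[OF fin signs]) auto
  moreover have "?S \<theta> [] = 2 * form U (\<lambda>u. sin (\<theta> u))"
    unfolding form_def sum_distrib_left
    by (intro sum.cong refl) (simp add: cos_add cos_diff)
  ultimately show ?case by simp
next
  case (Cons f fs)
  \<comment> \<open>Averaging over the sign of \<open>f\<close> shifts the phases by
    \<open>f\<close> or \<open>- f\<close>; hence the induction lets \<open>\<theta>\<close>
    vary.\<close>
  have *: "cos (x - y) * (cos (p - q) * P) - cos (x + y) * (cos (p + q) * Q)
      = (cos ((x + p) - (y + q)) * P - cos ((x + p) + (y + q)) * Q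
         + (cos ((x - p) - (y - q)) * P - cos ((x - p) + (y - q)) * Q)) / 2" for x y p q P Q :: real
  proof -
    have "cos ((x + p) - (y + q)) + cos ((x - p) - (y - q)) = 2 * cos (x - y) * cos (p - q)"
      using cos_add[of "x - y" "p - q"] cos_diff[of "x - y" "p - q"] by (simp add: algebra_simps)
    moreover have "cos ((x + p) + (y + q)) + cos ((x - p) + (y - q)) = 2 * cos (x + y) * cos (p + q)"
      using cos_add[of "x + y" "p + q"] cos_diff[of "x + y" "p + q"] by (simp add: algebra_simps)
    ultimately have
      "cos (x - y) * cos (p - q) = (cos ((x + p) - (y + q)) + cos ((x - p) - (y - q))) / 2"
      "cos (x + y) * cos (p + q) = (cos ((x + p) + (y + q)) + cos ((x - p) + (y - q))) / 2"
      by simp_all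
    then show ?thesis unfolding mult.assoc[symmetric] by (simp add: algebra_simps)
  qed
  have "?S \<theta> (f # fs) = (?S (\<lambda>u. \<theta> u + f u) fs + ?S (\<lambda>u. \<theta> u - f u) fs) / 2"
    unfolding sum.distrib[symmetric] sum_divide_distrib
    by (intro sum.cong refl) (subst list.map, subst list.map, subst prod_list.Cons,
      subst prod_list.Cons, subst *, simp add: distrib_left)
  then show ?case using Cons[of "\<lambda>u. \<theta> u + f u"] Cons[of "\<lambda>u. \<theta> u - f u"] by simp
qed

text \<open>Each function is replaced by \<open>N\<close> copies divided by \<open>sqrt N\<close>.
  The bound does not depend on \<open>N\<close>, so it passes to the Gaussian limit.\<close>

lemma gaussian_average:
  assumes fin: "finite U"
    and signs: "\<And>x. (\<And>u. x u = 1 \<or> x u = -1) \<Longrightarrow> form U x \<ge> - B"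
  shows "(\<Sum>u\<in>U. \<Sum>v\<in>U. a u v *
            (exp (- (\<Sum>f\<leftarrow>fs. (f u - f v)\<^sup>2) / 2) - exp (- (\<Sum>f\<leftarrow>fs. (f u + f v)\<^sup>2) / 2))) \<ge> - (2 * B)"
proof -
  define gs where "gs N = concat (replicate N (map (\<lambda>f u. f u / sqrt (real N)) fs))" for N
  have "(\<Sum>u\<in>U. \<Sum>v\<in>U. a u v *
            (prod_list (map (\<lambda>f. cos ((f u - f v) / sqrt (real N))) fs) ^ N
             - prod_list (map (\<lambda>f. cos ((f u + f v) / sqrt (real N))) fs) ^ N)) \<ge> - (2 * B)" for N
    using rademacher_average[OF fin signs, where \<theta> = "\<lambda>_. 0" and fs = "gs N"]
    by (simp add: gs_def prod_list_concat_replicate o_def diff_divide_distrib add_divide_distrib)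
  moreover have "(\<lambda>N. \<Sum>u\<in>U. \<Sum>v\<in>U. a u v *
            (prod_list (map (\<lambda>f. cos ((f u - f v) / sqrt (real N))) fs) ^ N
             - prod_list (map (\<lambda>f. cos ((f u + f v) / sqrt (real N))) fs) ^ N))
     \<longlonglongrightarrow> (\<Sum>u\<in>U. \<Sum>v\<in>U. a u v *
            (exp (- (\<Sum>f\<leftarrow>fs. (f u - f v)\<^sup>2) / 2) - exp (- (\<Sum>f\<leftarrow>fs. (f u + f v)\<^sup>2) / 2)))"
    by (intro tendsto_intros cos_prod_limit)
  ultimately show ?thesis
    by (intro LIMSEQ_le_const) auto
qed

text \<open>The surplus certified by vectors, up to a constant factor and counting ordered edges.\<close>

definition vec_sp :: "'a set \<Rightarrow> real \<Rightarrow> bool" where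
  "vec_sp U s \<longleftrightarrow> (\<exists>fs. (\<forall>u\<in>U. gram fs u u \<le> 1) \<and>
     (\<Sum>u\<in>U. \<Sum>v\<in>U. a u v * penalty (gram fs u v)) \<le> - s)"

lemma vec_sp_le: "vec_sp U s \<Longrightarrow> t \<le> s \<Longrightarrow> vec_sp U t"
  unfolding vec_sp_def by force

lemma vec_sp_zero: "t \<le> 0 \<Longrightarrow> vec_sp U t"
  unfolding vec_sp_def by (intro exI[of _ "[]"]) (auto simp: gram_def)

text \<open>The Gaussian average is bounded edge by edge through \<open>exp_diff_penalty\<close>;
  this loses a factor \<open>exp 1 \<le> 3\<close>.\<close>

lemma vec_sp_round:
  assumes fin: "finite U" and vs: "vec_sp U s"
    and signs: "\<And>x. (\<And>u. x u = 1 \<or> x u = -1) \<Longrightarrow> form U x \<ge> - B"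
  shows "s \<le> 3 * B"
proof -
  from vs obtain fs where fs: "\<And>u. u \<in> U \<Longrightarrow> gram fs u u \<le> 1"
    "(\<Sum>u\<in>U. \<Sum>v\<in>U. a u v * penalty (gram fs u v)) \<le> - s"
    unfolding vec_sp_def by blast
  have m: "(\<Sum>f\<leftarrow>fs. (f u - f v)\<^sup>2) = gram fs u u + gram fs v v - 2 * gram fs u v" for u v
    unfolding gram_def by (induction fs) (auto simp: power2_eq_square algebra_simps)
  have p: "(\<Sum>f\<leftarrow>fs. (f u + f v)\<^sup>2) = gram fs u u + gram fs v v + 2 * gram fs u v" for u v
    unfolding gram_def by (induction fs) (auto simp: power2_eq_square algebra_simps)
  have nn: "(\<Sum>f\<leftarrow>fs. (f u - f v)\<^sup>2) \<ge> 0" for u v by (intro sum_list_nonneg) auto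
  have "- (2 * B) \<le> (\<Sum>u\<in>U. \<Sum>v\<in>U. a u v *
            (exp (- (\<Sum>f\<leftarrow>fs. (f u - f v)\<^sup>2) / 2) - exp (- (\<Sum>f\<leftarrow>fs. (f u + f v)\<^sup>2) / 2)))"
    by (rule gaussian_average[OF fin signs])
  also have "\<dots> \<le> (\<Sum>u\<in>U. \<Sum>v\<in>U. a u v * (2 * exp (-1) * penalty (gram fs u v)))"
  proof (intro sum_mono mult_left_mono a_nonneg)
    fix u v assume "u \<in> U" "v \<in> U"
    \<comment> \<open>With \<open>s\<close> the mean of the two squared norms, \<open>nn\<close>
      gives \<open>\<rho> \<le> s\<close>, and norms at most 1 give
      \<open>s \<le> 1\<close>.\<close>
    have e: "- (gram fs u u + gram fs v v - 2 * gram fs u v) / 2 = gram fs u v - (gram fs u u + gram fs v v) / 2"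
      "- (gram fs u u + gram fs v v + 2 * gram fs u v) / 2 = - gram fs u v - (gram fs u u + gram fs v v) / 2"
      by (simp_all add: field_simps)
    from \<open>u \<in> U\<close> \<open>v \<in> U\<close> have "exp (gram fs u v - (gram fs u u + gram fs v v) / 2) -
       exp (- gram fs u v - (gram fs u u + gram fs v v) / 2) \<le> 2 * exp (-1) * penalty (gram fs u v)"
      using fs(1)[of u] fs(1)[of v] nn[of u v] by (intro exp_diff_penalty) (auto simp: m)
    then show "exp (- (\<Sum>f\<leftarrow>fs. (f u - f v)\<^sup>2) / 2) - exp (- (\<Sum>f\<leftarrow>fs. (f u + f v)\<^sup>2) / 2)
       \<le> 2 * exp (-1) * penalty (gram fs u v)"
      unfolding m p e .
  qed
  also have "\<dots> = 2 * exp (-1) * (\<Sum>u\<in>U. \<Sum>v\<in>U. a u v * penalty (gram fs u v))"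
    by (simp add: sum_distrib_left mult_ac)
  also have "\<dots> \<le> 2 * exp (-1) * (- s)" using fs(2) by (intro mult_left_mono) auto
  finally have *: "exp (-1) * s \<le> B" by simp
  then have "s \<le> exp 1 * B" by (simp add: exp_minus field_simps)
  \<comment> \<open>The form vanishes at the zero vector, which lies in the cube. The sign of
    \<open>B\<close> allows \<open>exp 1\<close> to be replaced by 3.\<close>
  have "B \<ge> 0"
  proof (rule ccontr)
    assume "\<not> B \<ge> 0"
    moreover have "form U (\<lambda>u. 0) \<ge> - B"
      by (rule form_cube[OF fin signs]) auto
    ultimately show False by (simp add: form_def)
  qed
  then have "exp 1 * B \<le> 3 * B" using exp_le by (intro mult_right_mono) auto
  with \<open>s \<le> exp 1 * B\<close> show ?thesis by linarith
qed

section \<open>Constructions of vectors\<close>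

definition nb :: "'a set \<Rightarrow> 'a \<Rightarrow> 'a set" where
  "nb U w = {u \<in> U. a w u = 1}"

definition dg :: "'a set \<Rightarrow> 'a \<Rightarrow> real" where
  "dg U u = (\<Sum>v\<in>U. a u v)"

text \<open>Every edge and every triangle is counted with all its orderings: \<open>ed U\<close> is twice the number
  of edges and \<open>tri U\<close> is six times the number of triangles.\<close>

definition ed :: "'a set \<Rightarrow> real" where
  "ed U = (\<Sum>u\<in>U. \<Sum>v\<in>U. a u v)"

definition tri :: "'a set \<Rightarrow> real" where
  "tri U = (\<Sum>w\<in>U. ed (nb U w))"

definition cross :: "'a set \<Rightarrow> 'a set \<Rightarrow> real" where
  "cross A B = (\<Sum>u\<in>A. \<Sum>v\<in>B. a u v)"

lemma nb_subset: "nb U w \<subseteq> U" by (auto simp: nb_def)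

lemma finite_nb [simp]: "finite U \<Longrightarrow> finite (nb U w)" by (simp add: nb_def)

lemma sum_nb:
  assumes "finite U"
  shows "(\<Sum>u\<in>nb U w. g u) = (\<Sum>u\<in>U. a w u * g u)"
proof -
  have "(\<Sum>u\<in>nb U w. g u) = (\<Sum>u\<in>U. if a w u = 1 then g u else 0)"
    unfolding nb_def using assms by (simp add: sum.inter_filter)
  also have "\<dots> = (\<Sum>u\<in>U. a w u * g u)"
    using a01[of w] by (intro sum.cong) auto
  finally show ?thesis .
qed

lemma card_nb: "finite U \<Longrightarrow> real (card (nb U w)) = dg U w"
  using sum_nb[of U "\<lambda>_. 1" w] by (simp add: dg_def)

lemma dg_nonneg: "dg U u \<ge> 0" by (simp add: dg_def sum_nonneg)

lemma ed_nonneg: "ed U \<ge> 0" by (simp add: ed_def sum_nonneg)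

lemma ed_eq_sum_dg: "ed U = (\<Sum>u\<in>U. dg U u)" by (simp add: ed_def dg_def)

lemma dg_mono: "finite U \<Longrightarrow> A \<subseteq> U \<Longrightarrow> dg A u \<le> dg U u"
  unfolding dg_def by (intro sum_mono2) auto

lemma ed_le_square: "ed U \<le> real (card U) ^ 2"
proof -
  have "ed U \<le> (\<Sum>u\<in>U. \<Sum>v\<in>U. 1)" unfolding ed_def by (intro sum_mono a_le1)
  then show ?thesis by (simp add: power2_eq_square)
qed

lemma ed_zero_if_empty: "card U = 0 \<Longrightarrow> ed U = 0"
  using ed_le_square[of U] ed_nonneg[of U] by simp

text \<open>Double counting links the two uses of \<open>tri\<close>: edges inside neighbourhoods
  serve the induction on cliques, codegrees are inner products of neighbourhood indicators.\<close>

lemma tri_eq_codegree: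
  assumes "finite U"
  shows "tri U = (\<Sum>u\<in>U. \<Sum>v\<in>U. a u v * (\<Sum>w\<in>U. a u w * a v w))"
proof -
  have "tri U = (\<Sum>w\<in>U. \<Sum>u\<in>U. \<Sum>v\<in>U. a u v * (a u w * a v w))"
    unfolding tri_def ed_def using assms
    by (simp add: sum_nb sum_distrib_left a_sym mult_ac)
  also have "\<dots> = (\<Sum>u\<in>U. \<Sum>w\<in>U. \<Sum>v\<in>U. a u v * (a u w * a v w))"
    by (rule sum.swap)
  also have "\<dots> = (\<Sum>u\<in>U. \<Sum>v\<in>U. \<Sum>w\<in>U. a u v * (a u w * a v w))"
    by (intro sum.cong refl sum.swap)
  finally show ?thesis by (simp add: sum_distrib_left)
qed

section \<open>Restricting, scaling and concatenating vectors\<close>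

text \<open>The vectors are extended by zero outside \<open>W\<close>. Their support is what
  controls norms when vectors of many sets are concatenated.\<close>

lemma vec_sp_supported:
  assumes "vec_sp W s" "finite U" "W \<subseteq> U"
  obtains fs where "\<And>u v. u \<notin> W \<or> v \<notin> W \<Longrightarrow> gram fs u v = 0" "\<And>u. u \<in> W \<Longrightarrow> gram fs u u \<le> 1"
    "(\<Sum>u\<in>U. \<Sum>v\<in>U. a u v * penalty (gram fs u v)) \<le> - s"
proof -
  from assms(1) obtain fs where fs: "\<forall>u\<in>W. gram fs u u \<le> 1"
    "(\<Sum>u\<in>W. \<Sum>v\<in>W. a u v * penalty (gram fs u v)) \<le> - s"
    unfolding vec_sp_def by blast
  define gs where "gs = map (\<lambda>f u. (if u \<in> W then 1 else 0) * f u) fs"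
  have gs: "gram gs u v = (if u \<in> W then 1 else 0) * (if v \<in> W then 1 else 0) * gram fs u v" for u v
    unfolding gs_def by (rule gram_scale)
  have "(\<Sum>u\<in>U. \<Sum>v\<in>U. a u v * penalty (gram gs u v)) = (\<Sum>u\<in>W. \<Sum>v\<in>U. a u v * penalty (gram gs u v))"
    using assms by (intro sum.mono_neutral_right) (auto simp: gs)
  also have "\<dots> = (\<Sum>u\<in>W. \<Sum>v\<in>W. a u v * penalty (gram gs u v))"
    using assms by (intro sum.cong refl sum.mono_neutral_right) (auto simp: gs)
  also have "\<dots> \<le> - s" using fs(2) by (simp add: gs)
  finally show ?thesis using fs(1) that[of gs] by (auto simp: gs)
qed

lemma vec_sp_mono:
  assumes "vec_sp W s" "finite U" "W \<subseteq> U"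
  shows "vec_sp U s"
proof -
  from vec_sp_supported[OF assms] obtain fs where
    "\<And>u v. u \<notin> W \<or> v \<notin> W \<Longrightarrow> gram fs u v = 0" "\<And>u. u \<in> W \<Longrightarrow> gram fs u u \<le> 1"
    "(\<Sum>u\<in>U. \<Sum>v\<in>U. a u v * penalty (gram fs u v)) \<le> - s" by blast
  then show ?thesis unfolding vec_sp_def
    by (intro exI[of _ fs]) (metis zero_le_one)
qed

lemma vec_sp_scaled:
  assumes "D > 0" and "\<And>u. u \<in> U \<Longrightarrow> gram fs u u \<le> D"
    and "(\<Sum>u\<in>U. \<Sum>v\<in>U. a u v * penalty (gram fs u v)) \<le> - s"
  shows "vec_sp U (s / D)"
proof -
  define gs where "gs = map (\<lambda>f u. (1 / sqrt D) * f u) fs"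
  have gs: "gram gs u v = (1 / D) * gram fs u v" for u v
    unfolding gs_def using gram_scale[of "\<lambda>_. 1 / sqrt D" fs u v] assms(1) by simp
  have "(\<Sum>u\<in>U. \<Sum>v\<in>U. a u v * penalty (gram gs u v))
      = (1 / D) * (\<Sum>u\<in>U. \<Sum>v\<in>U. a u v * penalty (gram fs u v))"
    unfolding gs using assms(1) by (subst penalty_scale) (auto simp: sum_distrib_left mult_ac)
  also have "\<dots> \<le> (1 / D) * (- s)" using assms by (intro mult_left_mono) auto
  finally show ?thesis unfolding vec_sp_def using assms
    by (intro exI[of _ gs]) (auto simp: gs)
qed

text \<open>A vertex lies in as many neighbourhoods as its degree, so the concatenated vectors have
  squared norm at most \<open>D\<close>, while subadditivity of \<open>penalty\<close> lets the
  surpluses add up.\<close>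

lemma vec_sp_neighbourhoods:
  assumes fin: "finite U" and D: "D > 0" "\<And>u. u \<in> U \<Longrightarrow> dg U u \<le> D"
    and s: "\<And>w. w \<in> U \<Longrightarrow> vec_sp (nb U w) (s w)"
  shows "vec_sp U ((\<Sum>w\<in>U. s w) / D)"
proof -
  define Q where "Q w fs \<longleftrightarrow> (\<forall>u v. u \<notin> nb U w \<or> v \<notin> nb U w \<longrightarrow> gram fs u v = 0) \<and>
    (\<forall>u\<in>nb U w. gram fs u u \<le> 1) \<and>
    (\<Sum>u\<in>U. \<Sum>v\<in>U. a u v * penalty (gram fs u v)) \<le> - s w" for w fs
  have "\<exists>fs. Q w fs" if "w \<in> U" for w
    by (rule vec_sp_supported[OF s[OF that] fin nb_subset]) (auto simp: Q_def)
  then obtain F where F: "\<And>w. w \<in> U \<Longrightarrow> Q w (F w)" by metis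
  have F0: "gram (F w) u v = 0" if "w \<in> U" "u \<notin> nb U w \<or> v \<notin> nb U w" for w u v
    using F[OF that(1)] that(2) unfolding Q_def by blast
  have F1: "gram (F w) u u \<le> 1" if "w \<in> U" "u \<in> nb U w" for w u
    using F[OF that(1)] that(2) unfolding Q_def by blast
  have F2: "(\<Sum>u\<in>U. \<Sum>v\<in>U. a u v * penalty (gram (F w) u v)) \<le> - s w" if "w \<in> U" for w
    using F[OF that] unfolding Q_def by blast
  obtain fs where fs: "\<And>u v. gram fs u v = (\<Sum>w\<in>U. gram (F w) u v)"
    using gram_family[OF fin] by blast
  show ?thesis
  proof (rule vec_sp_scaled[OF D(1)])
    fix u assume u: "u \<in> U"
    have "gram fs u u \<le> (\<Sum>w\<in>U. a u w)" unfolding fs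
    proof (intro sum_mono)
      fix w assume w: "w \<in> U"
      show "gram (F w) u u \<le> a u w"
      proof (cases "u \<in> nb U w")
        case True
        then have "a u w = 1" by (simp add: nb_def a_sym)
        then show ?thesis using F1[OF w True] by simp
      qed (simp add: F0[OF w])
    qed
    then show "gram fs u u \<le> D" using D(2)[OF u] by (simp add: dg_def)
  next
    have "(\<Sum>u\<in>U. \<Sum>v\<in>U. a u v * penalty (gram fs u v))
        \<le> (\<Sum>u\<in>U. \<Sum>v\<in>U. a u v * (\<Sum>w\<in>U. penalty (gram (F w) u v)))"
      unfolding fs by (intro sum_mono mult_left_mono penalty_sum a_nonneg)
    also have "\<dots> = (\<Sum>u\<in>U. \<Sum>v\<in>U. \<Sum>w\<in>U. a u v * penalty (gram (F w) u v))"
      by (simp add: sum_distrib_left)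
    also have "\<dots> = (\<Sum>u\<in>U. \<Sum>w\<in>U. \<Sum>v\<in>U. a u v * penalty (gram (F w) u v))"
      by (intro sum.cong refl sum.swap)
    also have "\<dots> = (\<Sum>w\<in>U. \<Sum>u\<in>U. \<Sum>v\<in>U. a u v * penalty (gram (F w) u v))"
      by (rule sum.swap)
    also have "\<dots> \<le> (\<Sum>w\<in>U. - s w)" by (intro sum_mono F2)
    finally show "(\<Sum>u\<in>U. \<Sum>v\<in>U. a u v * penalty (gram fs u v)) \<le> - (\<Sum>w\<in>U. s w)"
      by (simp add: sum_negf)
  qed
qed

section \<open>Perturbed neighbourhood vectors\<close>

lemma sum_dg_left: "(\<Sum>u\<in>U. \<Sum>v\<in>U. a u v * dg U u) = (\<Sum>u\<in>U. (dg U u)\<^sup>2)"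
  by (simp add: dg_def sum_distrib_right[symmetric] power2_eq_square)

lemma sum_dg_right: "(\<Sum>u\<in>U. \<Sum>v\<in>U. a u v * dg U v) = (\<Sum>u\<in>U. (dg U u)\<^sup>2)"
  by (subst sum.swap) (simp add: a_sym sum_dg_left[symmetric])

lemma ed_square_le:
  assumes "finite U"
  shows "(ed U)\<^sup>2 \<le> real (card U) * (\<Sum>u\<in>U. (dg U u)\<^sup>2)"
proof (cases "U = {}")
  case False
  with assms have n: "card U > 0" by (simp add: card_gt_0_iff)
  have "real (card U) * (ed U / real (card U))\<^sup>2 \<le> (\<Sum>u\<in>U. (dg U u)\<^sup>2)"
    using weighted_power_mean[of U "\<lambda>_. 1" "dg U" 1] n
    by (simp add: ed_eq_sum_dg dg_nonneg power2_eq_square)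
  then show ?thesis using n by (simp add: field_simps power2_eq_square)
qed (simp add: ed_def)

text \<open>The vector of \<open>u\<close> is the indicator of its neighbourhood shifted by a constant below the edge
  density, so that adjacent vertices with few common neighbours become negatively correlated.\<close>

lemma vec_sp_few_triangles_dense:
  assumes fin: "finite U" and N: "real (card U) \<le> N" "N > 0"
    and D: "D > 0" "\<And>u. u \<in> U \<Longrightarrow> dg U u \<le> D"
    and T: "tri U \<le> ed U ^ 3 / (32 * N ^ 3)"
  shows "vec_sp U (ed U ^ 3 / (16 * N ^ 3 * D))"
proof -
  let ?E = "ed U"
  let ?n = "real (card U)"
  \<comment> \<open>This value minimises the bound \<open>- 2 * \<alpha> * (?E\<^sup>2 / N) + 4 *
    \<alpha>\<^sup>2 * ?E * N\<close> reached below, giving \<open>- (?E ^ 3 / (4 * N ^ 3))\<close>;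
    the triangle term returns half of that gain.\<close>
  define \<alpha> where "\<alpha> = ?E / (4 * N\<^sup>2)"
  have E0: "?E \<ge> 0" by (rule ed_nonneg)
  have EN: "?E \<le> N\<^sup>2"
    using ed_le_square[of U] N power_mono[of ?n N 2] by linarith
  have ED: "?E \<le> N * D"
  proof -
    have "?E \<le> (\<Sum>u\<in>U. D)" unfolding ed_eq_sum_dg by (intro sum_mono D)
    also have "\<dots> = ?n * D" by simp
    also have "\<dots> \<le> N * D" using N D by (intro mult_right_mono) auto
    finally show ?thesis .
  qed
  have a0: "\<alpha> \<ge> 0" using E0 by (simp add: \<alpha>_def)
  have aN: "\<alpha> * N \<le> D"
    using ED E0 N D mult_pos_pos[OF N(2) D(1)] by (simp add: \<alpha>_def power2_eq_square field_simps)
  have "?E \<le> 4 * N\<^sup>2" using EN zero_le_power2[of N] by linarith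
  then have a1: "\<alpha> \<le> 1" using N by (simp add: \<alpha>_def field_simps)
  obtain fs where fs: "\<And>u v. gram fs u v = (\<Sum>w\<in>U. (a u w - \<alpha>) * (a v w - \<alpha>))"
    using gram_functions[OF fin, of "\<lambda>w u. a u w - \<alpha>"] by blast
  have g: "gram fs u v = (\<Sum>w\<in>U. a u w * a v w) - \<alpha> * (dg U u + dg U v) + \<alpha>\<^sup>2 * ?n" for u v
    unfolding fs dg_def
    by (simp add: algebra_simps sum.distrib sum_subtractf sum_distrib_left power2_eq_square)
  \<comment> \<open>The squared norm is at most the degree plus the shift term
    \<open>\<alpha>\<^sup>2 * ?n\<close>, each at most \<open>D\<close>.\<close>
  have "vec_sp U ((?E ^ 3 / (8 * N ^ 3)) / (2 * D))"
  proof (rule vec_sp_scaled)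
    show "2 * D > 0" using D by simp
  next
    fix u assume u: "u \<in> U"
    have "(\<Sum>w\<in>U. a u w * a u w) = dg U u"
      unfolding dg_def using a01[of u] by (intro sum.cong) auto
    then have "gram fs u u \<le> dg U u + \<alpha> * (\<alpha> * ?n)"
      using a0 dg_nonneg[of U u] by (simp add: g power2_eq_square)
    also have "\<dots> \<le> dg U u + 1 * (\<alpha> * N)"
      using a0 a1 N by (intro add_left_mono mult_mono) auto
    finally show "gram fs u u \<le> 2 * D" using aN D(2)[OF u] by simp
  next
    have p: "penalty (c - x + y) \<le> 4 * c - x + 4 * y" if "c \<ge> 0" "x \<ge> 0" "y \<ge> 0" for c x y
      using that by (auto simp: penalty_def)
    have "(\<Sum>u\<in>U. \<Sum>v\<in>U. a u v * penalty (gram fs u v))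
        \<le> (\<Sum>u\<in>U. \<Sum>v\<in>U. a u v * (4 * (\<Sum>w\<in>U. a u w * a v w) - \<alpha> * (dg U u + dg U v) + 4 * (\<alpha>\<^sup>2 * ?n)))"
      unfolding g using a0 dg_nonneg
      by (intro sum_mono mult_left_mono p a_nonneg sum_nonneg mult_nonneg_nonneg add_nonneg_nonneg) auto
    also have "\<dots> = 4 * tri U - \<alpha> * ((\<Sum>u\<in>U. \<Sum>v\<in>U. a u v * dg U u) + (\<Sum>u\<in>U. \<Sum>v\<in>U. a u v * dg U v))
        + 4 * (\<alpha>\<^sup>2 * ?n) * ?E"
      unfolding tri_eq_codegree[OF fin] ed_def
      by (simp add: sum_distrib_left sum_distrib_right sum.distrib sum_subtractf algebra_simps)
    also have "\<dots> = 4 * tri U - 2 * \<alpha> * (\<Sum>u\<in>U. (dg U u)\<^sup>2) + 4 * \<alpha>\<^sup>2 * ?E * ?n"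
      unfolding sum_dg_left sum_dg_right by (simp add: algebra_simps)
    also have "\<dots> \<le> 4 * (?E ^ 3 / (32 * N ^ 3)) - 2 * \<alpha> * (?E\<^sup>2 / N) + 4 * \<alpha>\<^sup>2 * ?E * N"
    proof -
      have "?E\<^sup>2 \<le> N * (\<Sum>u\<in>U. (dg U u)\<^sup>2)"
        using ed_square_le[OF fin] N mult_right_mono[of ?n N "\<Sum>u\<in>U. (dg U u)\<^sup>2"]
        by (smt (verit) sum_nonneg zero_le_power2)
      then have "?E\<^sup>2 / N \<le> (\<Sum>u\<in>U. (dg U u)\<^sup>2)"
        using N by (simp add: field_simps)
      then have "2 * \<alpha> * (?E\<^sup>2 / N) \<le> 2 * \<alpha> * (\<Sum>u\<in>U. (dg U u)\<^sup>2)"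
        using a0 by (intro mult_left_mono) auto
      moreover have "4 * \<alpha>\<^sup>2 * ?E * ?n \<le> 4 * \<alpha>\<^sup>2 * ?E * N"
        using E0 N by (intro mult_left_mono) auto
      ultimately show ?thesis using T by linarith
    qed
    also have "\<dots> = - (?E ^ 3 / (8 * N ^ 3))"
      using N by (simp add: \<alpha>_def field_simps power2_eq_square power3_eq_cube)
    finally show "(\<Sum>u\<in>U. \<Sum>v\<in>U. a u v * penalty (gram fs u v)) \<le> - (?E ^ 3 / (8 * N ^ 3))" .
  qed
  then show ?thesis by (simp add: mult_ac)
qed

text \<open>The vector of \<open>u\<close> is half the unit vector at \<open>u\<close> minus
  \<open>b\<close> times the indicator of its neighbourhood. On an edge the two mixed terms give
  \<open>- b\<close> and common neighbours give \<open>b\<^sup>2\<close> each; the squared norm is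
  at most \<open>1 / 4 + 3 / 4\<close>.\<close>

lemma vec_sp_few_triangles_sparse:
  assumes fin: "finite U" and b: "b \<ge> 0" "\<And>u. u \<in> U \<Longrightarrow> b\<^sup>2 * dg U u \<le> 3 / 4"
  shows "vec_sp U (b * ed U - 4 * b\<^sup>2 * tri U)"
proof -
  define \<delta> where "\<delta> u w = (if w = u then 1 / 2 else 0 :: real)" for u w :: 'a
  obtain fs where fs: "\<And>u v. gram fs u v = (\<Sum>w\<in>U. (\<delta> u w - b * a u w) * (\<delta> v w - b * a v w))"
    using gram_functions[OF fin, of "\<lambda>w u. \<delta> u w - b * a u w"] by blast
  have g: "gram fs u v = (if u = v then 1 / 4 else 0) - b * a u v + b\<^sup>2 * (\<Sum>w\<in>U. a u w * a v w)"
    if "u \<in> U" "v \<in> U" for u v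
  proof -
    have "gram fs u v = (\<Sum>w\<in>U. \<delta> u w * \<delta> v w) - b * (\<Sum>w\<in>U. \<delta> u w * a v w) - b * (\<Sum>w\<in>U. \<delta> v w * a u w)
        + b\<^sup>2 * (\<Sum>w\<in>U. a u w * a v w)"
      unfolding fs
      by (simp add: algebra_simps sum.distrib sum_subtractf sum_distrib_left power2_eq_square)
    moreover have "(\<Sum>w\<in>U. \<delta> x w * h w) = h x / 2" if "x \<in> U" for x and h :: "'a \<Rightarrow> real"
    proof -
      have "(\<Sum>w\<in>U. \<delta> x w * h w) = (\<Sum>w\<in>U. if w = x then h w / 2 else 0)"
        by (intro sum.cong) (auto simp: \<delta>_def)
      then show ?thesis using that fin by simp
    qed
    ultimately have "gram fs u v = \<delta> v u / 2 - b * (a v u / 2) - b * (a u v / 2)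
        + b\<^sup>2 * (\<Sum>w\<in>U. a u w * a v w)" using that by simp
    then show ?thesis using a_sym[of v u] by (simp add: \<delta>_def)
  qed
  have "(\<Sum>u\<in>U. \<Sum>v\<in>U. a u v * penalty (gram fs u v))
      \<le> (\<Sum>u\<in>U. \<Sum>v\<in>U. - b * a u v + 4 * b\<^sup>2 * (a u v * (\<Sum>w\<in>U. a u w * a v w)))"
  proof (intro sum_mono)
    fix u v assume uv: "u \<in> U" "v \<in> U"
    show "a u v * penalty (gram fs u v) \<le> - b * a u v + 4 * b\<^sup>2 * (a u v * (\<Sum>w\<in>U. a u w * a v w))"
    proof (cases "a u v = 0")
      case False
      then have "a u v = 1" "u \<noteq> v" using a01[of u v] by auto
      moreover have "(\<Sum>w\<in>U. a u w * a v w) \<ge> 0" by (intro sum_nonneg) auto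
      then have "penalty (- b + b\<^sup>2 * (\<Sum>w\<in>U. a u w * a v w)) \<le> - b + 4 * (b\<^sup>2 * (\<Sum>w\<in>U. a u w * a v w))"
        using penalty_add[of "- b" "b\<^sup>2 * (\<Sum>w\<in>U. a u w * a v w)"] b
        by (simp add: penalty_nonneg penalty_nonpos)
      ultimately show ?thesis using uv by (simp add: g)
    qed simp
  qed
  also have "\<dots> = - (b * ed U - 4 * b\<^sup>2 * tri U)"
    unfolding tri_eq_codegree[OF fin] ed_def
    by (simp add: sum.distrib sum_negf sum_subtractf sum_distrib_left)
  finally have "(\<Sum>u\<in>U. \<Sum>v\<in>U. a u v * penalty (gram fs u v)) \<le> - (b * ed U - 4 * b\<^sup>2 * tri U)" .
  moreover have "gram fs u u \<le> 1" if u: "u \<in> U" for u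
  proof -
    have "(\<Sum>w\<in>U. a u w * a u w) = dg U u"
      unfolding dg_def using a01[of u] by (intro sum.cong) auto
    then show ?thesis using b(2)[OF u] by (simp add: g[OF u u])
  qed
  ultimately show ?thesis unfolding vec_sp_def by blast
qed

section \<open>Surplus from a bipartition\<close>

lemma ed_partition:
  assumes "finite U" "H \<subseteq> U"
  shows "ed U = ed H + ed (U - H) + 2 * cross H (U - H)"
proof -
  have sp: "sum g U = sum g H + sum g (U - H)" for g :: "'a \<Rightarrow> real"
    using assms by (metis sum.subset_diff add.commute)
  have "cross (U - H) H = cross H (U - H)"
    unfolding cross_def by (subst sum.swap) (simp add: a_sym)
  then show ?thesis unfolding ed_def cross_def by (simp add: sp sum.distrib)
qed

text \<open>One-dimensional vectors: 1 on \<open>H\<close> and -1 elsewhere. Crossing pairs count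
  \<open>- 1\<close>, pairs inside a part count 4.\<close>

lemma vec_sp_cut:
  assumes "finite U" "H \<subseteq> U"
  shows "vec_sp U (2 * cross H (U - H) - 4 * (ed H + ed (U - H)))"
proof -
  define f where "f u = (if u \<in> H then 1 else -1 :: real)" for u
  have sp: "sum g U = sum g H + sum g (U - H)" for g :: "'a \<Rightarrow> real"
    using assms by (metis sum.subset_diff add.commute)
  have c: "cross (U - H) H = cross H (U - H)"
    unfolding cross_def by (subst sum.swap) (simp add: a_sym)
  have "(\<Sum>u\<in>U. \<Sum>v\<in>U. a u v * penalty (gram [f] u v))
     = 4 * ed H + 4 * ed (U - H) - cross H (U - H) - cross (U - H) H"
    unfolding ed_def cross_def
    by (simp add: sp sum.distrib gram_def f_def penalty_def sum_distrib_right[symmetric] sum_negf)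
  then show ?thesis unfolding vec_sp_def
    by (intro exI[of _ "[f]"]) (auto simp: gram_def f_def c)
qed

text \<open>If the parts span less than a sixth of the edges, at least five sixths cross, and
  \<open>5 / 6 - 4 / 6 = 1 / 6\<close>.\<close>

lemma vec_sp_cut_or_dense_part:
  assumes "finite U" "H \<subseteq> U"
  shows "vec_sp U (ed U / 6) \<or> ed H + ed (U - H) \<ge> ed U / 6"
proof (cases "ed H + ed (U - H) \<ge> ed U / 6")
  case False
  then show ?thesis
    using vec_sp_le[OF vec_sp_cut[OF assms], of "ed U / 6"] ed_partition[OF assms] by simp
qed simp

section \<open>Cliques and neighbourhoods\<close>

definition clique_free :: "nat \<Rightarrow> 'a set \<Rightarrow> bool" where
  "clique_free r U \<longleftrightarrow>
     \<not> (\<exists>S\<subseteq>U. finite S \<and> card S = r \<and> (\<forall>u\<in>S. \<forall>v\<in>S. u \<noteq> v \<longrightarrow> a u v = 1))"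

lemma clique_free_mono: "clique_free r U \<Longrightarrow> W \<subseteq> U \<Longrightarrow> clique_free r W"
  unfolding clique_free_def by blast

lemma clique_free_nb:
  assumes "clique_free (Suc r) U" "w \<in> U"
  shows "clique_free r (nb U w)"
  unfolding clique_free_def
proof
  assume "\<exists>S\<subseteq>nb U w. finite S \<and> card S = r \<and> (\<forall>u\<in>S. \<forall>v\<in>S. u \<noteq> v \<longrightarrow> a u v = 1)"
  then obtain S where S: "S \<subseteq> nb U w" "finite S" "card S = r" "\<forall>u\<in>S. \<forall>v\<in>S. u \<noteq> v \<longrightarrow> a u v = 1"
    by blast
  have adj: "a w u = 1" "a u w = 1" if "u \<in> S" for u
    using S(1) that a_sym by (auto simp: nb_def)
  then have "w \<notin> S" using a_diag[of w] by force
  then have "insert w S \<subseteq> U \<and> finite (insert w S) \<and> card (insert w S) = Suc r \<and>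
      (\<forall>u\<in>insert w S. \<forall>v\<in>insert w S. u \<noteq> v \<longrightarrow> a u v = 1)"
    using S assms(2) adj by (auto simp: nb_def)
  then show False using assms(1) unfolding clique_free_def by blast
qed

lemma ed_clique_free_2:
  assumes "clique_free 2 U"
  shows "ed U = 0"
proof -
  have "a u v = 0" if "u \<in> U" "v \<in> U" for u v
  proof (rule ccontr)
    assume "a u v \<noteq> 0"
    then have "a u v = 1" "u \<noteq> v" using a01[of u v] by auto
    moreover have "a v u = 1" using calculation(1) a_sym by metis
    ultimately have "{u, v} \<subseteq> U \<and> finite {u, v} \<and> card {u, v} = 2 \<and>
      (\<forall>x\<in>{u, v}. \<forall>y\<in>{u, v}. x \<noteq> y \<longrightarrow> a x y = 1)"
      using that by auto
    then show False using assms unfolding clique_free_def by blast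
  qed
  then show ?thesis by (simp add: ed_def)
qed

section \<open>Clique-free graphs\<close>

text \<open>The bounds for the neighbourhoods are added and divided by \<open>D\<close>. Replacing
  one of the two factors \<open>dg U w\<close> in the density by \<open>D\<close> prepares Jensen
  with degrees as weights; these sum to \<open>ed U\<close>, and the edges in neighbourhoods sum to
  \<open>tri U\<close>.\<close>

lemma vec_sp_many_triangles:
  assumes fin: "finite U" and D: "D > 0" "\<And>u. u \<in> U \<Longrightarrow> dg U u \<le> D" and c: "c \<ge> 0"
    and IH: "\<And>w. w \<in> U \<Longrightarrow>
      vec_sp (nb U w) (c * ed (nb U w) * (ed (nb U w) / (real (card (nb U w)))\<^sup>2) ^ k)"
    and E: "ed U > 0"
  shows "vec_sp U (c * ed U * (tri U / (ed U * D)) ^ Suc k)"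
proof -
  let ?e = "\<lambda>w. ed (nb U w)" and ?d = "dg U"
  \<comment> \<open>Isolated vertices, where the quotients divide by zero, contribute
    nothing.\<close>
  have z: "?e w = 0" if "?d w = 0" for w
    using that card_nb[OF fin, of w] ed_zero_if_empty[of "nb U w"] by simp
  have e0: "?e w \<ge> 0" for w by (rule ed_nonneg)
  have "vec_sp U ((\<Sum>w\<in>U. c * ?e w * (?e w / (?d w)\<^sup>2) ^ k) / D)"
    using vec_sp_neighbourhoods[OF fin D IH] by (simp add: card_nb[OF fin])
  moreover have "c * ed U * (tri U / (ed U * D)) ^ Suc k \<le> (\<Sum>w\<in>U. c * ?e w * (?e w / (?d w)\<^sup>2) ^ k) / D"
  proof -
    have "ed U * (tri U / ed U) ^ Suc k \<le> (\<Sum>w\<in>U. ?d w * (?e w / ?d w) ^ Suc k)"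
      using weighted_power_mean[of U ?d ?e k] E z e0 dg_nonneg by (simp add: ed_eq_sum_dg tri_def)
    then have "c / D ^ Suc k * (ed U * (tri U / ed U) ^ Suc k) \<le>
        c / D ^ Suc k * (\<Sum>w\<in>U. ?d w * (?e w / ?d w) ^ Suc k)"
      using c D by (intro mult_left_mono) auto
    also have "\<dots> = (\<Sum>w\<in>U. c * (?d w * (?e w / ?d w) ^ Suc k) / D ^ k) / D"
      by (simp add: sum_distrib_left sum_divide_distrib mult_ac)
    also have "\<dots> \<le> (\<Sum>w\<in>U. c * ?e w * (?e w / (?d w)\<^sup>2) ^ k) / D"
    proof (intro divide_right_mono sum_mono)
      fix w assume w: "w \<in> U"
      show "c * (?d w * (?e w / ?d w) ^ Suc k) / D ^ k \<le> c * ?e w * (?e w / (?d w)\<^sup>2) ^ k"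
      proof (cases "?d w = 0")
        case False
        then have d: "?d w > 0" using dg_nonneg[of U w] by simp
        have "c * (?d w * (?e w / ?d w) ^ Suc k) / D ^ k = c * ?e w * (?e w / (?d w * D)) ^ k"
          using d by (simp add: power_mult_distrib power_divide)
        also have "\<dots> \<le> c * ?e w * (?e w / (?d w)\<^sup>2) ^ k"
          using d D e0[of w] c
          by (intro mult_left_mono power_mono divide_left_mono) (auto simp: power2_eq_square w)
        finally show ?thesis .
      qed (simp add: z)
    qed (use D in simp)
    also have "c / D ^ Suc k * (ed U * (tri U / ed U) ^ Suc k) = c * ed U * (tri U / (ed U * D)) ^ Suc k"
      by (simp only: divide_divide_eq_left[symmetric] power_divide) simp
    finally show ?thesis .
  qed
  ultimately show ?thesis by (rule vec_sp_le)
qed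

text \<open>Markov's inequality for the degree sum.\<close>

lemma card_high_degree:
  assumes "finite U" "t \<ge> 0"
  shows "real (card {u \<in> U. dg U u > t}) * t \<le> ed U"
proof -
  have "real (card {u \<in> U. dg U u > t}) * t = (\<Sum>u\<in>{u \<in> U. dg U u > t}. t)" by simp
  also have "\<dots> \<le> (\<Sum>u\<in>{u \<in> U. dg U u > t}. dg U u)" by (intro sum_mono) auto
  also have "\<dots> \<le> (\<Sum>u\<in>U. dg U u)" using assms by (intro sum_mono2) (auto simp: dg_nonneg)
  finally show ?thesis by (simp add: ed_eq_sum_dg)
qed

text \<open>Here \<open>E\<close> and \<open>n\<close> measure an ambient graph and \<open>L\<close>
  is its low-degree part. Few triangles are handled by shifted neighbourhood vectors, many triangles
  by \<open>IH\<close> inside the neighbourhoods.\<close>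

lemma vec_sp_bounded_degree_step:
  assumes fin: "finite L" and cf: "clique_free (k + 3) L"
    and n: "real (card L) \<le> n" "n > 0" and E: "E > 0" "ed L \<ge> E / 12" "E \<le> n\<^sup>2"
    and deg: "\<And>u. u \<in> L \<Longrightarrow> dg L u \<le> 12 * E / n"
    and c: "c > 0" "c \<le> 1 / 331776" "c \<le> ck / (12 * 55296 ^ Suc k)" and ck: "ck > 0"
    and IH: "\<And>W. finite W \<Longrightarrow> clique_free (k + 2) W \<Longrightarrow>
      vec_sp W (ck * ed W * (ed W / (real (card W))\<^sup>2) ^ k)"
  shows "vec_sp L (c * E * (E / n\<^sup>2) ^ Suc k)"
proof -
  let ?\<rho> = "E / n\<^sup>2" and ?E' = "ed L" and ?D = "12 * E / n"
  have D: "?D > 0" using n E by simp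
  have E'0: "?E' > 0" using E by linarith
  have \<rho>: "0 \<le> ?\<rho>" "?\<rho> \<le> 1" using E n by auto
  have \<rho>k: "?\<rho> ^ k \<le> 1" using \<rho> by (intro power_le_one) auto
  show ?thesis
  proof (cases "tri L \<le> ?E' ^ 3 / (32 * n ^ 3)")
    case True
    have "vec_sp L (?E' ^ 3 / (16 * n ^ 3 * ?D))"
      by (rule vec_sp_few_triangles_dense[OF fin n D deg True])
    moreover have "c * E * ?\<rho> ^ Suc k \<le> ?E' ^ 3 / (16 * n ^ 3 * ?D)"
    proof -
      have "c * (E * (?\<rho> * ?\<rho> ^ k)) \<le> 1 / 331776 * (E * (?\<rho> * 1))"
        using c E \<rho> \<rho>k by (intro mult_mono) auto
      also have "\<dots> = (E / 12) ^ 3 / (16 * n ^ 3 * ?D)"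
        using n E by (simp add: field_simps power2_eq_square power3_eq_cube)
      also have "\<dots> \<le> ?E' ^ 3 / (16 * n ^ 3 * ?D)"
        using E n by (intro divide_right_mono power_mono) auto
      finally show ?thesis by (simp add: mult_ac)
    qed
    ultimately show ?thesis by (rule vec_sp_le)
  next
    case False
    have "vec_sp L (ck * ?E' * (tri L / (?E' * ?D)) ^ Suc k)"
    proof (rule vec_sp_many_triangles[OF fin D deg _ _ E'0])
      fix w assume "w \<in> L"
      then have "clique_free (k + 2) (nb L w)"
        using cf clique_free_nb[of "k + 2" L w] by (simp add: numeral_3_eq_3)
      then show "vec_sp (nb L w) (ck * ed (nb L w) * (ed (nb L w) / (real (card (nb L w)))\<^sup>2) ^ k)"
        using fin by (intro IH) auto
    qed (use ck in auto)
    moreover have "c * E * ?\<rho> ^ Suc k \<le> ck * ?E' * (tri L / (?E' * ?D)) ^ Suc k"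
    proof -
      have "?\<rho> / 55296 = (E / 12)\<^sup>2 / (32 * n ^ 3) / ?D"
        using n E by (simp add: field_simps power2_eq_square power3_eq_cube)
      also have "\<dots> \<le> ?E'\<^sup>2 / (32 * n ^ 3) / ?D"
        using E n by (intro divide_right_mono power_mono) auto
      also have "\<dots> = ?E' ^ 3 / (32 * n ^ 3) / (?E' * ?D)"
        using E'0 by (simp add: power2_eq_square power3_eq_cube)
      also have "\<dots> \<le> tri L / (?E' * ?D)"
        using False mult_pos_pos[OF E'0 D] by (intro divide_right_mono) linarith+
      finally have *: "?\<rho> / 55296 \<le> tri L / (?E' * ?D)" .
      have "c * (E * ?\<rho> ^ Suc k) \<le> ck / (12 * 55296 ^ Suc k) * (E * ?\<rho> ^ Suc k)"
        using c E \<rho> by (intro mult_right_mono) auto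
      also have "\<dots> = ck * (E / 12) * (?\<rho> / 55296) ^ Suc k"
        by (simp only: power_divide) (simp add: field_simps)
      also have "\<dots> \<le> ck * ?E' * (tri L / (?E' * ?D)) ^ Suc k"
        using ck E * \<rho> E'0 by (intro mult_mono power_mono) auto
      finally show ?thesis by (simp add: mult_ac)
    qed
    ultimately show ?thesis by (rule vec_sp_le)
  qed
qed

text \<open>The outer induction lowers the clique size. For fixed \<open>k\<close> an inner
  induction on the number of vertices treats the case that the high-degree vertices span many
  edges.\<close>

lemma vec_sp_clique_free:
  assumes "finite U" "clique_free (k + 2) U"
  shows "vec_sp U (dense_const k * ed U * (ed U / (real (card U))\<^sup>2) ^ k)"
  using assms
proof (induction k arbitrary: U)
  case 0
  then have "ed U = 0" by (intro ed_clique_free_2) (simp add: numeral_2_eq_2)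
  then show ?case by (simp add: vec_sp_zero)
next
  case (Suc k)
  note IH = Suc.IH
  define c where "c = dense_const (Suc k)"
  have ck: "dense_const k > 0" and c: "c > 0" "c \<le> 1 / 331776" "c \<le> dense_const k / (12 * 55296 ^ Suc k)"
    using dense_const_pos[of k] dense_const_pos[of "Suc k"] by (auto simp: c_def)
  have "vec_sp U (c * ed U * (ed U / (real (card U))\<^sup>2) ^ Suc k)"
    using Suc.prems
  proof (induction "card U" arbitrary: U rule: less_induct)
    case less
    let ?E = "ed U" and ?n = "real (card U)"
    show ?case
    proof (cases "?E = 0")
      case False
      then have E: "?E > 0" using ed_nonneg[of U] by simp
      then have n: "?n > 0" using ed_zero_if_empty[of U] by (cases "card U = 0") auto
      have En: "?E \<le> ?n\<^sup>2" by (rule ed_le_square)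
      have \<rho>: "0 \<le> ?E / ?n\<^sup>2" "?E / ?n\<^sup>2 \<le> 1" using E En n by auto
      \<comment> \<open>The threshold is 12 times the average degree, so \<open>H\<close> has at
        most \<open>?n / 12\<close> vertices.\<close>
      define H where "H = {u \<in> U. dg U u > 12 * ?E / ?n}"
      have HU: "H \<subseteq> U" by (auto simp: H_def)
      have finH: "finite H" "finite (U - H)" using less.prems(1) HU finite_subset by auto
      have "real (card H) * (12 * ?E / ?n) \<le> ?E"
        unfolding H_def using less.prems E n by (intro card_high_degree) auto
      then have cH: "real (card H) \<le> ?n / 12" using E n by (simp add: field_simps)
      consider "vec_sp U (?E / 6)" | "ed H \<ge> ?E / 12" | "ed (U - H) \<ge> ?E / 12"
        using vec_sp_cut_or_dense_part[OF less.prems(1) HU] by linarith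
      then show ?thesis
      proof cases
        case 1
        have "c * (?E * (?E / ?n\<^sup>2) ^ Suc k) \<le> 1 / 6 * (?E * 1)"
          using c E \<rho> by (intro mult_mono power_le_one) auto
        then show ?thesis using 1 by (auto intro: vec_sp_le)
      next
        case 2
        then have h: "real (card H) > 0"
          using E ed_zero_if_empty[of H] by (cases "card H = 0") auto
        have "card H < card U" using cH n by linarith
        then have "vec_sp H (c * ed H * (ed H / (real (card H))\<^sup>2) ^ Suc k)"
          using finH clique_free_mono[OF less.prems(2) HU] by (intro less.hyps) auto
        then have "vec_sp U (c * ed H * (ed H / (real (card H))\<^sup>2) ^ Suc k)"
          using less.prems(1) HU by (rule vec_sp_mono)
        moreover have "c * ?E * (?E / ?n\<^sup>2) ^ Suc k \<le> c * ed H * (ed H / (real (card H))\<^sup>2) ^ Suc k"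
        proof -
          \<comment> \<open>With a twelfth of the edges on a twelfth of the vertices, the density
            grows at least 12-fold. Its power \<open>Suc k\<close> makes up for the loss in
            edges.\<close>
          have "12 * (?E / ?n\<^sup>2) = (?E / 12) / (?n / 12)\<^sup>2" by (simp add: power2_eq_square)
          also have "\<dots> \<le> ed H / (real (card H))\<^sup>2"
            using 2 E h cH by (intro frac_le power_mono) auto
          finally have *: "12 * (?E / ?n\<^sup>2) \<le> ed H / (real (card H))\<^sup>2" .
          have "c * ?E * (?E / ?n\<^sup>2) ^ Suc k * 1 \<le> c * ?E * (?E / ?n\<^sup>2) ^ Suc k * 12 ^ k"
            using c E \<rho> by (intro mult_left_mono one_le_power) auto
          also have "\<dots> = c * (?E / 12) * (12 * (?E / ?n\<^sup>2)) ^ Suc k"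
            by (simp only: power_mult_distrib) (simp add: field_simps)
          also have "\<dots> \<le> c * ed H * (ed H / (real (card H))\<^sup>2) ^ Suc k"
            using c 2 E * \<rho> ed_nonneg[of H] by (intro mult_mono power_mono) auto
          finally show ?thesis by simp
        qed
        ultimately show ?thesis by (rule vec_sp_le)
      next
        case 3
        have "vec_sp (U - H) (c * ?E * (?E / ?n\<^sup>2) ^ Suc k)"
        proof (rule vec_sp_bounded_degree_step[OF finH(2) _ _ n E 3 En _ c ck IH])
          show "clique_free (k + 3) (U - H)"
            using clique_free_mono[OF less.prems(2), of "U - H"] by (simp add: numeral_3_eq_3)
          show "real (card (U - H)) \<le> ?n"
            using less.prems(1) by (simp add: card_mono)
          show "dg (U - H) u \<le> 12 * ?E / ?n" if "u \<in> U - H" for u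
            using that dg_mono[OF less.prems(1), of "U - H" u] by (auto simp: H_def)
        qed
        then show ?thesis using less.prems(1) by (rule vec_sp_mono) auto
      qed
    qed (auto intro: vec_sp_zero)
  qed
  then show ?case unfolding c_def .
qed

text \<open>The number \<open>\<theta>\<close> is \<open>D powr ((k + 1) / (k + 2))\<close>,
  described by integer powers. At \<open>tri U = \<theta> * ed U\<close> the two methods both give
  order \<open>ed U / \<theta>\<close>.\<close>

lemma vec_sp_bounded_degree:
  assumes fin: "finite U" and cf: "clique_free (k + 3) U"
    and D: "D > 0" "\<And>u. u \<in> U \<Longrightarrow> dg U u \<le> D"
    and \<theta>: "\<theta> > 0" "\<theta>\<^sup>2 \<ge> D" "\<theta> ^ (k + 2) = D ^ (k + 1)"
  shows "vec_sp U (sparse_const k * ed U / \<theta>)"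
proof (cases "ed U = 0")
  case False
  then have E: "ed U > 0" using ed_nonneg[of U] by simp
  show ?thesis
  proof (cases "tri U \<le> \<theta> * ed U")
    case True
    \<comment> \<open>This \<open>b\<close> maximises
      \<open>b * ed U - 4 * b\<^sup>2 * (\<theta> * ed U)\<close>, with value
      \<open>ed U / (16 * \<theta>)\<close>.\<close>
    define b where "b = 1 / (8 * \<theta>)"
    have b: "b \<ge> 0" using \<theta> by (simp add: b_def)
    have "vec_sp U (b * ed U - 4 * b\<^sup>2 * tri U)"
    proof (rule vec_sp_few_triangles_sparse[OF fin b])
      fix u assume "u \<in> U"
      then have "b\<^sup>2 * dg U u \<le> b\<^sup>2 * \<theta>\<^sup>2" using D(2)[of u] \<theta> by (intro mult_left_mono) auto
      also have "\<dots> \<le> 3 / 4" using \<theta> by (simp add: b_def power_divide power_mult_distrib)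
      finally show "b\<^sup>2 * dg U u \<le> 3 / 4" .
    qed
    moreover have "sparse_const k * ed U / \<theta> \<le> b * ed U - 4 * b\<^sup>2 * tri U"
    proof -
      have "sparse_const k * (ed U / \<theta>) \<le> 1 / 16 * (ed U / \<theta>)"
        using E \<theta> by (intro mult_right_mono) (auto simp: sparse_const_def)
      also have "\<dots> = b * ed U - 4 * b\<^sup>2 * (\<theta> * ed U)"
        using \<theta> by (simp add: b_def power2_eq_square field_simps)
      also have "\<dots> \<le> b * ed U - 4 * b\<^sup>2 * tri U"
        using True by (intro diff_left_mono mult_left_mono) auto
      finally show ?thesis by simp
    qed
    ultimately show ?thesis by (rule vec_sp_le)
  next
    case False
    have "vec_sp U (dense_const k * ed U * (tri U / (ed U * D)) ^ Suc k)"
    proof (rule vec_sp_many_triangles[OF fin D _ _ E])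
      fix w assume "w \<in> U"
      then have "clique_free (k + 2) (nb U w)"
        using cf clique_free_nb[of "k + 2" U w] by (simp add: numeral_3_eq_3)
      then show "vec_sp (nb U w) (dense_const k * ed (nb U w) * (ed (nb U w) / (real (card (nb U w)))\<^sup>2) ^ k)"
        using fin by (intro vec_sp_clique_free) auto
    qed (use dense_const_pos[of k] in auto)
    moreover have "sparse_const k * ed U / \<theta> \<le> dense_const k * ed U * (tri U / (ed U * D)) ^ Suc k"
    proof -
      have "sparse_const k * (ed U / \<theta>) \<le> dense_const k * (ed U / \<theta>)"
        using E \<theta> by (intro mult_right_mono) (auto simp: sparse_const_def)
      \<comment> \<open>By \<open>\<theta> ^ (k + 2) = D ^ (k + 1)\<close>, the power on the right
        is \<open>1 / \<theta>\<close>.\<close>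
      also have "\<dots> = dense_const k * ed U * (\<theta> / D) ^ Suc k"
        using \<theta> D by (simp add: power_divide field_simps)
      also have "\<dots> \<le> dense_const k * ed U * (tri U / (ed U * D)) ^ Suc k"
      proof -
        have "\<theta> / D \<le> tri U / (ed U * D)" using False E D by (simp add: field_simps)
        then show ?thesis using dense_const_pos[of k] E \<theta> D by (intro mult_left_mono power_mono) auto
      qed
      finally show ?thesis by simp
    qed
    ultimately show ?thesis by (rule vec_sp_le)
  qed
qed (auto intro: vec_sp_zero)

text \<open>Vertices are split at degree of order \<open>ed V powr \<delta>\<close>. A high-degree
  part with many edges is dense since it is small; otherwise the bounded-degree estimate applies to
  the rest.\<close>

lemma vec_sp_clique_free_edges:
  assumes fin: "finite V" and cf: "clique_free (k + 3) V" and M1: "ed V \<ge> 1"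
  shows "vec_sp V (surplus_const k * ed V powr ((real k + 4) / (2 * real k + 5)))"
proof -
  define c where "c = surplus_const k"
  define c1 where "c1 = dense_const (Suc k)"
  define c2 where "c2 = sparse_const k"
  have c1: "c1 > 0" and c2: "c2 > 0"
    using dense_const_pos[of k] dense_const_pos[of "Suc k"] by (auto simp: c1_def c2_def sparse_const_def)
  then have c: "c > 0" "c \<le> 1 / 6" "c \<le> c1" "c \<le> c2 / 288"
    by (auto simp: c_def surplus_const_def c1_def c2_def)
  have dense: "vec_sp U (c1 * ed U * (ed U / (real (card U))\<^sup>2) ^ Suc k)"
    if "finite U" "clique_free (k + 3) U" for U
    using vec_sp_clique_free[of U "Suc k"] that unfolding c1_def by (simp add: numeral_3_eq_3)
  define \<beta> where "\<beta> = (real k + 4) / (2 * real k + 5)"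
  define \<delta> where "\<delta> = (real k + 2) / (2 * real k + 5)"
  define \<eta> where "\<eta> = (real k + 1) / (real k + 2)"
  have \<beta>: "\<beta> \<le> 1" by (simp add: \<beta>_def)
  \<comment> \<open>The balance of the two sides: the high-degree part yields
    \<open>D\<^sup>2 * (D\<^sup>2 / ?M) ^ k\<close>, the low-degree part yields order
    \<open>?M / D powr \<eta>\<close>.\<close>
  have e1: "2 * \<delta> + real k * (2 * \<delta> - 1) = \<beta>" "1 - \<delta> * \<eta> = \<beta>"
  proof -
    have "2 * \<delta> - 1 = - (1 / (2 * real k + 5))" by (simp add: \<delta>_def field_simps)
    then have "2 * \<delta> + real k * (2 * \<delta> - 1) = 2 * \<delta> - real k / (2 * real k + 5)"
      by simp
    also have "\<dots> = (2 * (real k + 2) - real k) / (2 * real k + 5)"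
      by (simp only: \<delta>_def diff_divide_distrib times_divide_eq_right)
    finally show "2 * \<delta> + real k * (2 * \<delta> - 1) = \<beta>" by (simp add: \<beta>_def)
    have "\<delta> * \<eta> = (real k + 1) / (2 * real k + 5)" by (simp add: \<delta>_def \<eta>_def)
    then show "1 - \<delta> * \<eta> = \<beta>" by (simp add: \<beta>_def field_simps)
  qed
  have "vec_sp V (c * ed V powr \<beta>)"
  proof -
    let ?M = "ed V"
    define D where "D = ?M powr \<delta>"
    have D: "D \<ge> 1" unfolding D_def using M1 by (intro ge_one_powr_ge_zero) (auto simp: \<delta>_def)
    define H where "H = {u \<in> V. dg V u > 24 * D}"
    have HV: "H \<subseteq> V" by (auto simp: H_def)
    have finH: "finite H" "finite (V - H)" using fin HV finite_subset by auto
    have cH: "real (card H) * (24 * D) \<le> ?M"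
      unfolding H_def using fin D by (intro card_high_degree) auto
    then have cH': "2 * D * real (card H) \<le> ?M / 12" by (simp add: mult_ac)
    \<comment> \<open>Since \<open>2 * D * card H\<close> is at most \<open>?M / 12\<close>, failure
      of the second case leaves \<open>?M / 12\<close> to the complement.\<close>
    consider "vec_sp V (?M / 6)" | "ed H > 2 * D * real (card H)" | "ed (V - H) \<ge> ?M / 12"
      using vec_sp_cut_or_dense_part[OF fin HV] cH' by linarith
    then show ?thesis
    proof cases
      case 1
      have "c * ?M powr \<beta> \<le> 1 / 6 * ?M powr 1"
        using c \<beta> M1 by (intro mult_mono powr_mono) auto
      then show ?thesis using 1 M1 by (auto intro: vec_sp_le)
    next
      case 2
      then have h: "real (card H) > 0"
        using ed_zero_if_empty[of H] by (cases "card H = 0") auto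
      have "vec_sp V (c1 * ed H * (ed H / (real (card H))\<^sup>2) ^ Suc k)"
        using dense[OF finH(1) clique_free_mono[OF cf HV]] fin HV by (rule vec_sp_mono)
      moreover have "c * ?M powr \<beta> \<le> c1 * ed H * (ed H / (real (card H))\<^sup>2) ^ Suc k"
      proof -
        let ?h = "real (card H)"
        have D0: "D * ?h \<ge> 0" using D h by simp
        have q: "D \<le> ed H / ?h" using 2 h D0 by (simp add: field_simps)
        have "D * ?h \<le> ?M" using cH D0 by (simp add: algebra_simps)
        then have "D\<^sup>2 / ?M \<le> D / ?h" using D h M1 by (simp add: field_simps power2_eq_square)
        also have "\<dots> \<le> (ed H / ?h) / ?h" using q h by (intro divide_right_mono) auto
        also have "\<dots> = ed H / ?h\<^sup>2" by (simp add: power2_eq_square)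
        finally have p: "D\<^sup>2 / ?M \<le> ed H / ?h\<^sup>2" .
        \<comment> \<open>The bound for \<open>H\<close> factors as
          \<open>(ed H / ?h)\<^sup>2 * (ed H / ?h\<^sup>2) ^ k\<close>, to which \<open>q\<close>
          and \<open>p\<close> apply.\<close>
        have "?M powr \<beta> = D\<^sup>2 * (D\<^sup>2 / ?M) ^ k"
        proof -
          have D2: "D\<^sup>2 = ?M powr (2 * \<delta>)"
            using M1 by (simp add: D_def powr_realpow[symmetric] powr_powr mult.commute)
          then have "D\<^sup>2 / ?M = ?M powr (2 * \<delta> - 1)"
            using M1 by (simp add: powr_diff)
          then have "(D\<^sup>2 / ?M) ^ k = ?M powr (real k * (2 * \<delta> - 1))"
            using M1 by (simp add: powr_realpow[symmetric] powr_powr mult.commute)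
          with D2 show ?thesis by (simp add: powr_add[symmetric] e1)
        qed
        also have "\<dots> \<le> (ed H / ?h)\<^sup>2 * (ed H / ?h\<^sup>2) ^ k"
          using q p D M1 by (intro mult_mono power_mono) auto
        also have "\<dots> = ed H * (ed H / ?h\<^sup>2) ^ Suc k"
          by (simp add: power2_eq_square)
        finally have "c * ?M powr \<beta> \<le> c1 * (ed H * (ed H / ?h\<^sup>2) ^ Suc k)"
          using c c1 by (intro mult_mono) auto
        then show ?thesis by (simp add: mult.assoc)
      qed
      ultimately show ?thesis by (rule vec_sp_le)
    next
      case 3
      define \<theta> where "\<theta> = (24 * D) powr \<eta>"
      have D24: "24 * D > 0" "24 * D \<ge> 1" using D by auto
      have "vec_sp (V - H) (c2 * ed (V - H) / \<theta>)"
      unfolding c2_def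
      proof (rule vec_sp_bounded_degree[OF finH(2) clique_free_mono[OF cf] D24(1)])
        show "dg (V - H) u \<le> 24 * D" if "u \<in> V - H" for u
          using that dg_mono[OF fin, of "V - H" u] by (auto simp: H_def)
        show "\<theta> > 0" using D24 by (simp add: \<theta>_def)
        have "\<theta>\<^sup>2 = (24 * D) powr (2 * \<eta>)"
          using D24 by (simp add: \<theta>_def powr_realpow[symmetric] powr_powr mult.commute)
        also have "\<dots> \<ge> (24 * D) powr 1"
          using D24 by (intro powr_mono) (auto simp: \<eta>_def field_simps)
        finally show "24 * D \<le> \<theta>\<^sup>2" using D24 by simp
        have "\<theta> ^ (k + 2) = (24 * D) powr (\<eta> * real (k + 2))"
          using D24 by (simp only: \<theta>_def powr_powr powr_realpow[symmetric] powr_gt_zero)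
        also have "\<eta> * real (k + 2) = real (k + 1)" by (simp add: \<eta>_def field_simps)
        finally show "\<theta> ^ (k + 2) = (24 * D) ^ (k + 1)" using D24 by (simp only: powr_realpow)
      qed auto
      then have "vec_sp V (c2 * ed (V - H) / \<theta>)" using fin by (rule vec_sp_mono) auto
      moreover have "c * ?M powr \<beta> \<le> c2 * ed (V - H) / \<theta>"
      proof -
        have "\<theta> = 24 powr \<eta> * D powr \<eta>" using D by (simp add: \<theta>_def powr_mult)
        also have "\<dots> \<le> 24 powr 1 * ?M powr (\<delta> * \<eta>)"
          using M1 by (intro mult_mono powr_mono) (auto simp: D_def powr_powr \<eta>_def)
        finally have t: "\<theta> \<le> 24 * ?M powr (\<delta> * \<eta>)" by simp
        have \<beta>': "?M powr \<beta> = ?M / ?M powr (\<delta> * \<eta>)"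
          unfolding e1(2)[symmetric] using M1 by (simp add: powr_diff)
        have "c * ?M powr \<beta> \<le> c2 / 288 * ?M powr \<beta>"
          using c by (intro mult_right_mono) auto
        also have "\<dots> = c2 * (?M / 12) / (24 * ?M powr (\<delta> * \<eta>))" by (simp add: \<beta>')
        also have "\<dots> \<le> c2 * ed (V - H) / \<theta>"
          using 3 c2 M1 t D24 ed_nonneg by (intro frac_le mult_left_mono) (auto simp: \<theta>_def)
        finally show ?thesis .
      qed
      ultimately show ?thesis by (rule vec_sp_le)
    qed
  qed
  then show ?thesis by (simp add: \<beta>_def c_def)
qed

end

section \<open>From adjacency matrices back to edge sets\<close>

lemma sum_pairs_eq_twice_card:
  assumes "finite V" "\<forall>e\<in>F. e \<subseteq> V \<and> card e = 2"
  shows "(\<Sum>u\<in>V. \<Sum>v\<in>V. of_bool ({u, v} \<in> F)) = 2 * real (card F)"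
proof -
  have finF: "finite F" using assms by (meson PowI finite_Pow_iff finite_subset subsetI)
  have "(\<Sum>u\<in>V. \<Sum>v\<in>V. of_bool ({u, v} \<in> F) :: real) = (\<Sum>u\<in>V. \<Sum>v\<in>V. \<Sum>e\<in>F. of_bool ({u, v} = e))"
    using finF by (intro sum.cong refl) (auto simp: of_bool_def)
  also have "\<dots> = (\<Sum>u\<in>V. \<Sum>e\<in>F. \<Sum>v\<in>V. of_bool ({u, v} = e))"
    by (intro sum.cong refl sum.swap)
  also have "\<dots> = (\<Sum>e\<in>F. \<Sum>u\<in>V. \<Sum>v\<in>V. of_bool ({u, v} = e))"
    by (rule sum.swap)
  also have "\<dots> = (\<Sum>e\<in>F. 2)"
  proof (intro sum.cong refl)
    fix e assume "e \<in> F"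
    with assms obtain x y where e: "e = {x, y}" "x \<noteq> y" "x \<in> V" "y \<in> V"
      by (metis card_2_iff insert_subset)
    have "(\<Sum>v\<in>V. of_bool ({u, v} = e) :: real) = of_bool (u = x) + of_bool (u = y)" for u
    proof -
      have "(\<Sum>v\<in>V. of_bool ({u, v} = e) :: real)
          = (\<Sum>v\<in>V. (if v = y then of_bool (u = x) else 0) + (if v = x then of_bool (u = y) else 0))"
        using e by (intro sum.cong) (auto simp: doubleton_eq_iff)
      then show ?thesis using e assms(1) by (simp add: sum.distrib)
    qed
    then show "(\<Sum>u\<in>V. \<Sum>v\<in>V. of_bool ({u, v} = e) :: real) = 2"
      using e assms(1) by (simp add: sum.distrib of_bool_def)
  qed
  finally show ?thesis by simp
qed

lemma card_crossing_le_mc: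
  assumes "finite V" "finite E" "A \<subseteq> V"
  shows "card (crossing_edges E A (V - A)) \<le> mc V E"
  unfolding mc_def
proof (rule Max_ge)
  have "{card (crossing_edges E A B) |A B. A \<union> B = V \<and> A \<inter> B = {}} \<subseteq> {..card E}"
    using assms by (auto simp: crossing_edges_def intro!: card_mono)
  then show "finite {card (crossing_edges E A B) |A B. A \<union> B = V \<and> A \<inter> B = {}}"
    by (rule finite_subset) simp
qed (use assms in auto)

theorem theorem1p7:
  fixes r :: nat
  assumes "r \<ge> 3"
  shows "\<exists>c::real. c > 0 \<and>
    (\<forall>(V :: 'a set) (E :: 'a set set) (m :: nat).
      fin_simple_graph V E \<longrightarrow> K_free r V E \<longrightarrow> card E = m \<longrightarrow>
        sp V E \<ge> c * real m powr (1 / 2 + 3 / (4 * real r - 2)))"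
proof -
  \<comment> \<open>The induction parameter starts at cliques of size 3, the first nontrivial
    case.\<close>
  define k where "k = r - 3"
  have r: "r = k + 3" using assms by (simp add: k_def)
  have pos: "surplus_const k > 0"
    using dense_const_pos[of k] dense_const_pos[of "Suc k"] by (simp add: surplus_const_def sparse_const_def)
  define \<beta> where "\<beta> = (real k + 4) / (2 * real k + 5)"
  have exponent: "1 / 2 + 3 / (4 * real r - 2) = \<beta>" by (simp add: r \<beta>_def field_simps)
  \<comment> \<open>The 12 is \<open>3 * 4\<close>: rounding loses 3, and the quadratic form is
    bounded below by \<open>- 4\<close> times the surplus.\<close>
  have "surplus_const k / 12 * real (card E) powr \<beta> \<le> sp V E"
    if G: "fin_simple_graph V E" and free: "K_free r V E" for V :: "'a set" and E
  proof -
    have fin: "finite V" and E: "\<forall>e\<in>E. e \<subseteq> V \<and> card e = 2"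
      using G by (auto simp: fin_simple_graph_def)
    then have finE: "finite E" by (meson PowI finite_Pow_iff finite_subset subsetI)
    define a :: "'a \<Rightarrow> 'a \<Rightarrow> real" where "a u v = of_bool ({u, v} \<in> E)" for u v
    interpret graph01 a
      using E by unfold_locales (auto simp: a_def insert_commute)
    have ed: "ed V = 2 * real (card E)"
      unfolding ed_def a_def using sum_pairs_eq_twice_card[OF fin E] .
    \<comment> \<open>On signs the form equals \<open>ed V\<close> minus four times the cut, and
      \<open>ed V\<close> is twice the number of edges.\<close>
    have signs: "form V x \<ge> - (4 * sp V E)" if x: "\<And>u. x u = 1 \<or> x u = -1" for x
    proof -
      define A where "A = {u \<in> V. x u = 1}"
      let ?C = "crossing_edges E A (V - A)"
      have "ed V - form V x = (\<Sum>u\<in>V. \<Sum>v\<in>V. a u v * (1 - x u * x v))"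
        unfolding ed_def form_def by (simp add: sum_subtractf right_diff_distrib)
      also have "\<dots> = 2 * (\<Sum>u\<in>V. \<Sum>v\<in>V. of_bool ({u, v} \<in> ?C))"
        unfolding sum_distrib_left
      proof (intro sum.cong refl)
        fix u v assume uv: "u \<in> V" "v \<in> V"
        have "{u, v} \<in> ?C \<longleftrightarrow> {u, v} \<in> E \<and> x u \<noteq> x v"
        proof
          assume "{u, v} \<in> ?C"
          then show "{u, v} \<in> E \<and> x u \<noteq> x v"
            by (auto simp: crossing_edges_def A_def doubleton_eq_iff)
        next
          assume uvE: "{u, v} \<in> E \<and> x u \<noteq> x v"
          then have "u \<in> A \<and> v \<in> V - A \<or> v \<in> A \<and> u \<in> V - A"
            using uv x[of u] x[of v] by (auto simp: A_def)
          then show "{u, v} \<in> ?C"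
            using uvE unfolding crossing_edges_def by (auto simp: insert_commute)
        qed
        then show "a u v * (1 - x u * x v) = 2 * of_bool ({u, v} \<in> ?C)"
          using x[of u] x[of v] by (auto simp: a_def)
      qed
      also have "\<dots> = 4 * real (card ?C)"
        using sum_pairs_eq_twice_card[OF fin, of ?C] E by (simp add: crossing_edges_def)
      also have "\<dots> \<le> 4 * real (mc V E)"
        using card_crossing_le_mc[OF fin finE, of A] by (simp add: A_def)
      finally show ?thesis by (simp add: sp_def ed)
    qed
    have cf: "clique_free (k + 3) V"
      unfolding clique_free_def using free
      by (auto simp: K_free_def complete_subgraph_on_def a_def r)
    show ?thesis
    proof (cases "card E = 0")
      case True
      \<comment> \<open>Without edges the left side is 0 because \<open>0 powr \<beta> = 0\<close>,
        and the surplus is \<open>mc V E \<ge> 0\<close>.\<close>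
      then show ?thesis by (simp add: sp_def)
    next
      case False
      then have "vec_sp V (surplus_const k * ed V powr \<beta>)"
        unfolding \<beta>_def using fin cf by (intro vec_sp_clique_free_edges) (auto simp: ed)
      then have "surplus_const k * ed V powr \<beta> \<le> 3 * (4 * sp V E)"
        by (rule vec_sp_round[OF fin _ signs])
      moreover have "surplus_const k * real (card E) powr \<beta> \<le> surplus_const k * ed V powr \<beta>"
        using pos by (intro mult_left_mono powr_mono2) (auto simp: ed \<beta>_def)
      ultimately show ?thesis by simp
    qed
  qed
  then show ?thesis
    using pos unfolding exponent by (intro exI[of _ "surplus_const k / 12"]) auto
qed

end
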